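(* Let $\Omega\subseteq\mathbb C^m$ be a domain, let $K$ be a positive definite kernel defined on $\Omega$, and let $\lambda>0$ be an arbitrary real number. Then for a fixed but arbitrary $w$ in $\Omega$, the $(m+1)\times(m+1)$ matrix $$\big((\partial_j\bar\partial_iK^\lambda)(w,w)\big)_{i,j=0}^m$$ is positive definite.
   Context: $K(z,w)$ is holomorphic in the first variable $z$ and anti-holomorphic in the second variable $w$, and $K(w,w)>0$ on $\Omega$. The function $w\mapsto K(w,w)^\lambda$ is real analytic on $\Omega$; $K^\lambda(z,w)$ denotes its polarization (it is Hermitian, but is not assumed to be a positive definite kernel). For $1\le i,j\le m$, $\partial_j=\partial/\partial w_j$ and $\bar\partial_i=\partial/\partial\bar w_i$ act on $w\mapsto K(w,w)^\lambda$, while $\partial_0$ and $\bar\partial_0$ denote the identity; $(\partial_j\bar\partial_iK^\lambda)(w,w)$ is the resulting value at $w$.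
   Formalization: Strict positive definiteness fails in general (K=1; or 1+Σ_{n≥2} zⁿw̄ⁿ at 0); proved: the matrix is non-negative definite for every non-negative definite K, and strictly positive definite if K(·,w), ∂̄_1K(·,w),…,∂̄_mK(·,w) are linearly independent (also necessary). *)

theory Defs
  imports "HOL-Analysis.Analysis"
begin

text \<open>
  Points of complex m-space have type \<^typ>\<open>complex ^ 'm\<close> with m = CARD('m).
  Holomorphy in several variables: the real Frechet derivative exists and is complex linear.
\<close>

definition holomorphic_several_on ::
    "((complex ^ 'm) \<Rightarrow> complex) \<Rightarrow> (complex ^ 'm) set \<Rightarrow> bool" where
  "holomorphic_several_on f \<Omega> \<longleftrightarrow>
     (\<forall>z\<in>\<Omega>. \<exists>D :: complex ^ 'm. (f has_derivative (\<lambda>h. \<Sum>j\<in>UNIV. D $ j * h $ j)) (at z))"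

definition sesquiholomorphic_on ::
    "((complex ^ 'm) \<Rightarrow> (complex ^ 'm) \<Rightarrow> complex) \<Rightarrow> (complex ^ 'm) set \<Rightarrow> bool" where
  "sesquiholomorphic_on K \<Omega> \<longleftrightarrow>
     (\<forall>w\<in>\<Omega>. holomorphic_several_on (\<lambda>z. K z w) \<Omega>) \<and>
     (\<forall>z\<in>\<Omega>. holomorphic_several_on (\<lambda>w. cnj (K z w)) \<Omega>)"

text \<open>
  The kernel condition in Aronszajn's sense: every Gram matrix has a nonnegative quadratic form.
  Real-valuedness of all these forms makes the kernel Hermitian.
\<close>

definition nonneg_definite_kernel_on ::
    "('a \<Rightarrow> 'a \<Rightarrow> complex) \<Rightarrow> 'a set \<Rightarrow> bool" where
  "nonneg_definite_kernel_on K \<Omega> \<longleftrightarrow>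
     (\<forall>F c. finite F \<and> F \<subseteq> \<Omega> \<longrightarrow>
        (\<Sum>z\<in>F. \<Sum>w\<in>F. cnj (c z) * K z w * c w) \<in> \<real> \<and>
        0 \<le> Re (\<Sum>z\<in>F. \<Sum>w\<in>F. cnj (c z) * K z w * c w))"

definition hermitian_form :: "complex ^ 'n ^ 'n \<Rightarrow> complex ^ 'n \<Rightarrow> complex" where
  "hermitian_form A v = (\<Sum>i\<in>UNIV. \<Sum>j\<in>UNIV. cnj (v $ i) * A $ i $ j * v $ j)"

definition nonneg_definite_matrix :: "complex ^ 'n ^ 'n \<Rightarrow> bool" where
  "nonneg_definite_matrix A \<longleftrightarrow>
     (\<forall>v. hermitian_form A v \<in> \<real> \<and> 0 \<le> Re (hermitian_form A v))"

definition positive_definite_matrix :: "complex ^ 'n ^ 'n \<Rightarrow> bool" where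
  "positive_definite_matrix A \<longleftrightarrow>
     (\<forall>v. v \<noteq> 0 \<longrightarrow> hermitian_form A v \<in> \<real> \<and> 0 < Re (hermitian_form A v))"

definition directional_deriv ::
    "((complex ^ 'm) \<Rightarrow> complex) \<Rightarrow> complex ^ 'm \<Rightarrow> complex ^ 'm \<Rightarrow> complex" where
  "directional_deriv f v w = vector_derivative (\<lambda>t::real. f (w + t *\<^sub>R v)) (at 0)"

text \<open>
  Wirtinger derivatives, with x_j and y_j the real and imaginary parts of the j-th coordinate.
  The index \<^term>\<open>None\<close> plays the role of 0 (the identity operator), so that
  \<^typ>\<open>'m option\<close> is the index set {0, ..., m}.
\<close>

fun wirtinger :: "'m option \<Rightarrow> ((complex ^ 'm) \<Rightarrow> complex) \<Rightarrow> (complex ^ 'm) \<Rightarrow> complex" where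
  "wirtinger None f w = f w"
| "wirtinger (Some j) f w =
     (directional_deriv f (axis j 1) w - \<i> * directional_deriv f (axis j \<i>) w) / 2"

fun wirtinger_bar :: "'m option \<Rightarrow> ((complex ^ 'm) \<Rightarrow> complex) \<Rightarrow> (complex ^ 'm) \<Rightarrow> complex" where
  "wirtinger_bar None f w = f w"
| "wirtinger_bar (Some i) f w =
     (directional_deriv f (axis i 1) w + \<i> * directional_deriv f (axis i \<i>) w) / 2"

text \<open>
  \<^term>\<open>K w w\<close> is a positive real number wherever this is used.
\<close>

definition diag_power ::
    "((complex ^ 'm) \<Rightarrow> (complex ^ 'm) \<Rightarrow> complex) \<Rightarrow> real \<Rightarrow> (complex ^ 'm) \<Rightarrow> complex" where
  "diag_power K lam w = complex_of_real (Re (K w w) powr lam)"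

definition jet_matrix ::
    "((complex ^ 'm) \<Rightarrow> (complex ^ 'm) \<Rightarrow> complex) \<Rightarrow> real \<Rightarrow> complex ^ 'm
       \<Rightarrow> complex ^ ('m option) ^ ('m option)" where
  "jet_matrix K lam w = (\<chi> i j. wirtinger j (wirtinger_bar i (diag_power K lam)) w)"

text \<open>
  Strictness of the kernel to first order at w: the functions K(., w) and
  (d/d wbar_i) K(., w), i = 1, ..., m, are linearly independent on the domain.
  This is not implied by positivity of all Gram matrices at distinct points: the kernel
  K(z, w) = 1 + sum (n >= 2) z^n wbar^n on the unit disc has only positive definite Gram
  matrices (its space contains all polynomials p with p'(0) = 0, and these interpolate
  arbitrary data), but its first-order jet at 0 vanishes. There
  K(w, w) powr lam = 1 + lam |w|^4 + ... has jet matrix diag(1, 0).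
\<close>

definition first_order_strict_at ::
    "((complex ^ 'm) \<Rightarrow> (complex ^ 'm) \<Rightarrow> complex) \<Rightarrow> (complex ^ 'm) set \<Rightarrow> complex ^ 'm \<Rightarrow> bool" where
  "first_order_strict_at K \<Omega> w \<longleftrightarrow>
     (\<forall>c :: complex ^ ('m option).
        (\<forall>z\<in>\<Omega>. (\<Sum>i\<in>UNIV. c $ i * wirtinger_bar i (\<lambda>u. K z u) w) = 0) \<longrightarrow> c = 0)"

end

theory Submission
  imports Defs "HOL-Complex_Analysis.Conformal_Mappings"
begin

text \<open>
  On complex coordinate slices, \<open>K\<close> is separately holomorphic in \<open>z\<close> and \<open>cnj w\<close>, and locally bounded because
  \<open>|K z w|^2 \<le> K z z * K w w\<close>. The Schwarz lemma applied in each variable bounds the mixed second difference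
  by a multiple of \<open>|s| |t|\<close>, which replaces Hartogs' theorem: it gives joint differentiability on the
  diagonal and the convergence of difference quotients to mixed derivatives.

  With \<open>k = K w w\<close>, \<open>s = (\<Sum>j. \<partial>\<^sub>j K * v\<^sub>j)\<close> and \<open>q\<close> the form of the matrix of mixed derivatives of \<open>K\<close>,
  completing the square turns the form of the jet matrix of \<open>K powr lam\<close> into
  \<open>k powr lam * (|v\<^sub>0 + (lam / k) s|^2 + (lam / k) (q - |s|^2 / k))\<close>. The Cauchy-Schwarz inequality for Gram
  matrices, applied to difference quotients and passed to the limit, gives \<open>|s|^2 \<le> k q\<close>. If the form
  vanishes, the same inequality against an arbitrary \<open>K z\<close> shows that a combination of the first-order
  jet of \<open>K z\<close> at \<open>w\<close> is zero for every \<open>z\<close>, so that strictness forces \<open>v = 0\<close>.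
\<close>

section \<open>Estimates from the Schwarz lemma in one variable\<close>

text \<open>The rescaled function \<open>f (r * z) / M\<close> maps the unit disc into itself and
  fixes 0, so both claims are the Schwarz lemma in other units.\<close>

lemma Schwarz_bound:
  fixes f :: "complex \<Rightarrow> complex"
  assumes hol: "f holomorphic_on ball 0 r" and f0: "f 0 = 0" and r: "0 < r"
    and bnd: "\<And>z. z \<in> ball 0 r \<Longrightarrow> norm (f z) < M"
  shows "z \<in> ball 0 r \<Longrightarrow> norm (f z) \<le> M / r * norm z"
    and "norm (deriv f 0) \<le> M / r"
proof -
  have M: "0 < M" using bnd[of 0] r f0 by simp
  define g where "g = (\<lambda>z. f (of_real r * z) / of_real M)"
  have im: "(\<lambda>z. complex_of_real r * z) ` ball 0 1 \<subseteq> ball 0 r"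
    using r by (auto simp: norm_mult)
  have hg: "g holomorphic_on ball 0 1"
    unfolding g_def using holomorphic_on_compose_gen[OF _ hol im] M
    by (intro holomorphic_intros) (auto simp: o_def intro: holomorphic_intros)
  have g0: "g 0 = 0" by (simp add: g_def f0)
  have g1: "norm (g z) < 1" if "norm z < 1" for z
    using bnd[of "of_real r * z"] that r M im by (auto simp: g_def norm_divide norm_mult)
  note S = Schwarz_Lemma[OF hg g0 g1]
  show "norm (f z) \<le> M / r * norm z" if "z \<in> ball 0 r" for z
  proof -
    have "norm (z / of_real r) < 1" using that r by (simp add: norm_divide)
    from S(1)[OF _ this] show ?thesis using r M
      by (simp add: g_def norm_divide field_simps)
  qed
  have "(f has_field_derivative deriv f 0) (at (of_real r * 0))"
    using holomorphic_derivI[OF hol open_ball, of 0] r by simp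
  from DERIV_chain2[where g = "\<lambda>z. of_real r * z" and x = 0, OF this]
  have "((\<lambda>z. f (of_real r * z)) has_field_derivative deriv f 0 * of_real r) (at 0)"
    by (auto intro!: derivative_eq_intros)
  then have "(g has_field_derivative deriv f 0 * of_real r / of_real M) (at 0)"
    unfolding g_def by (rule DERIV_cdivide)
  then have "deriv g 0 = deriv f 0 * of_real r / of_real M" by (rule DERIV_imp_deriv)
  with S(2)[of 0] show "norm (deriv f 0) \<le> M / r"
    using r M by (simp add: norm_divide norm_mult field_simps)
qed

text \<open>After removing the singularity at 0, the difference quotient is holomorphic and, by a
  first use of \<open>Schwarz_bound\<close>, bounded by \<open>2 * M / r\<close>. A second use, on
  its deviation from the value at 0, gives the linear rate. The constant depends on \<open>f\<close>
  only through \<open>M\<close> and \<open>r\<close>, so the rate is uniform over families with a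
  common bound.\<close>

lemma Schwarz_difference_quotient:
  fixes f :: "complex \<Rightarrow> complex"
  assumes hol: "f holomorphic_on ball 0 r" and r: "0 < r"
    and bnd: "\<And>z. z \<in> ball 0 r \<Longrightarrow> norm (f z) < M"
    and h: "h \<in> ball 0 r" "h \<noteq> 0"
  shows "norm ((f h - f 0) / h - deriv f 0) \<le> 8 * M / r\<^sup>2 * norm h"
proof -
  have M: "0 < M" using bnd[of 0] r by (smt (verit) norm_ge_zero centre_in_ball)
  define f1 where "f1 = (\<lambda>z. f z - f 0)"
  have h1: "f1 holomorphic_on ball 0 r" unfolding f1_def by (intro holomorphic_intros hol)
  have f10: "f1 0 = 0" by (simp add: f1_def)
  have b1: "norm (f1 z) < 2 * M" if "z \<in> ball 0 r" for z
    using norm_triangle_ineq4[of "f z" "f 0"] bnd[OF that] bnd[of 0] r by (simp add: f1_def)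
  note S1 = Schwarz_bound[where f = f1 and M = "2 * M", OF h1 f10 r b1, simplified]
  have d1: "deriv f1 0 = deriv f 0"
    using holomorphic_derivI[OF hol open_ball, of 0] r
    by (intro DERIV_imp_deriv) (auto simp: f1_def intro!: derivative_eq_intros)
  define g where "g = (\<lambda>z. if z = 0 then deriv f 0 else (f z - f 0) / (z - 0))"
  have hg: "g holomorphic_on ball 0 r" unfolding g_def by (rule pole_lemma_open[OF hol open_ball])
  have bg: "norm (g z) \<le> 2 * M / r" if "z \<in> ball 0 r" for z
    using S1(1)[of z] S1(2) that r d1
    by (auto simp: g_def f1_def norm_divide field_simps)
  have hg2: "(\<lambda>z. g z - g 0) holomorphic_on ball 0 r" by (intro holomorphic_intros hg)
  \<comment> \<open>The triangle inequality yields \<open>4 * M / r\<close>; the larger constant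
    supplies the strict inequality that \<open>Schwarz_bound\<close> asks for.\<close>
  have "norm (g z - g 0) < 8 * M / r" if "z \<in> ball 0 r" for z
  proof -
    have "norm (g z - g 0) \<le> 2 * M / r + 2 * M / r"
      using norm_triangle_ineq4[of "g z" "g 0"] bg[OF that] bg[of 0] r by simp
    also have "\<dots> < 8 * M / r" using M r by (simp add: field_simps)
    finally show ?thesis .
  qed
  from Schwarz_bound(1)[OF hg2 _ r this h(1)]
  show ?thesis using h by (simp add: g_def power2_eq_square)
qed

section \<open>Bounded separately holomorphic functions on a bidisc\<close>

definition separately_holomorphic :: "(complex \<Rightarrow> complex \<Rightarrow> complex) \<Rightarrow> real \<Rightarrow> bool" where
  "separately_holomorphic F r \<longleftrightarrow>
     (\<forall>t\<in>ball 0 r. (\<lambda>s. F s t) holomorphic_on ball 0 r) \<and>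
     (\<forall>s\<in>ball 0 r. F s holomorphic_on ball 0 r)"

text \<open>The mixed difference vanishes on both axes. Schwarz in \<open>s\<close> gives a bound
  proportional to \<open>norm s\<close>, uniformly in \<open>t\<close>; this serves as the bound for
  Schwarz in \<open>t\<close>, which adds the factor \<open>norm t\<close>.\<close>

lemma mixed_difference_bound:
  assumes F: "separately_holomorphic F r" and r: "0 < r"
    and bnd: "\<And>s t. s \<in> ball 0 r \<Longrightarrow> t \<in> ball 0 r \<Longrightarrow> norm (F s t) < M"
    and s: "s \<in> ball 0 r" and t: "t \<in> ball 0 r"
  shows "norm (F s t - F s 0 - F 0 t + F 0 0) \<le> 8 * M / r\<^sup>2 * norm s * norm t"
proof -
  have M: "0 < M" using bnd[of 0 0] r by (smt (verit) norm_ge_zero centre_in_ball)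
  have r0: "0 \<in> ball 0 r" using r by simp
  define H where "H = (\<lambda>s t. F s t - F s 0 - F 0 t + F 0 0)"
  have H4: "norm (H s t) < 4 * M" if "s \<in> ball 0 r" "t \<in> ball 0 r" for s t
    using norm_triangle_ineq[of "F s t - F s 0 - F 0 t" "F 0 0"]
      norm_triangle_ineq4[of "F s t - F s 0" "F 0 t"] norm_triangle_ineq4[of "F s t" "F s 0"]
      bnd[OF that] bnd[OF that(1) r0] bnd[OF r0 that(2)] bnd[OF r0 r0]
    by (simp add: H_def)
  have h1: "(\<lambda>s. H s t) holomorphic_on ball 0 r" if "t \<in> ball 0 r" for t
    using F that r0 unfolding H_def separately_holomorphic_def by (intro holomorphic_intros) auto
  have h2: "H s holomorphic_on ball 0 r" if "s \<in> ball 0 r" for s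
    using F that r0 unfolding H_def separately_holomorphic_def
    by (intro holomorphic_intros) (auto simp: eta_contract_eq)
  have b1: "norm (H s t) \<le> 4 * M / r * norm s" if "t \<in> ball 0 r" "s \<in> ball 0 r" for s t
    by (rule Schwarz_bound(1)[OF h1 _ r]) (use H4 that in \<open>auto simp: H_def\<close>)
  show ?thesis
  proof (cases "s = 0")
    case False
    \<comment> \<open>Doubling the constant makes the bound strict, which is where \<open>s\<close>
      must be nonzero.\<close>
    have "norm (H s t) < 8 * M / r * norm s" if "t \<in> ball 0 r" for t
    proof -
      have "4 * M / r * norm s < 8 * M / r * norm s"
        using M r False by (simp add: field_simps)
      with b1[OF that s] show ?thesis by linarith
    qed
    from Schwarz_bound(1)[OF h2[OF s] _ r this t]
    have "norm (H s t) \<le> 8 * M / r * norm s / r * norm t" by (simp add: H_def)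
    then show ?thesis by (simp add: H_def power2_eq_square field_simps)
  qed simp
qed

lemma has_derivative_zero_of_quadratic_bound:
  fixes R :: "'a::real_normed_vector \<Rightarrow> 'b::real_normed_vector"
  assumes r: "0 < r" and bnd: "\<And>h. norm h < r \<Longrightarrow> norm (R h) \<le> C * (norm h)\<^sup>2"
  shows "(R has_derivative (\<lambda>_. 0)) (at 0)"
proof -
  have R0: "R 0 = 0" using bnd[of 0] r by simp
  have ev: "\<forall>\<^sub>F h in at (0::'a). norm (norm (R h) / norm h) \<le> C * norm h"
    unfolding eventually_at
  proof (intro exI conjI ballI impI)
    fix h :: 'a assume "h \<noteq> 0 \<and> dist h 0 < r"
    then show "norm (norm (R h) / norm h) \<le> C * norm h"
      using bnd[of h] by (simp add: divide_le_eq power2_eq_square mult.assoc)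
  qed (use r in auto)
  have "((\<lambda>h::'a. C * norm h) \<longlongrightarrow> 0) (at 0)" by (auto intro!: tendsto_eq_intros)
  from Lim_null_comparison[OF ev this] show ?thesis
    by (simp add: has_derivative_at R0)
qed

text \<open>Up to a constant, \<open>F s (cnj s)\<close> is the sum of its restrictions to the two
  axes and the mixed difference. The latter is quadratically small by
  \<open>mixed_difference_bound\<close>, so the first-order part comes from the axes alone.\<close>

lemma separately_holomorphic_conj_diagonal:
  assumes F: "separately_holomorphic F r" and r: "0 < r"
    and bnd: "\<And>s t. s \<in> ball 0 r \<Longrightarrow> t \<in> ball 0 r \<Longrightarrow> norm (F s t) < M"
  shows "((\<lambda>s. F s (cnj s)) has_derivative
           (\<lambda>h. deriv (\<lambda>s. F s 0) 0 * h + deriv (F 0) 0 * cnj h)) (at 0)"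
proof -
  have r0: "0 \<in> ball 0 r" using r by simp
  have "((\<lambda>s. F s (cnj s) - F s 0 - F 0 (cnj s) + F 0 0) has_derivative (\<lambda>_. 0)) (at 0)"
  proof (rule has_derivative_zero_of_quadratic_bound[OF r])
    fix h :: complex assume "norm h < r"
    then show "norm (F h (cnj h) - F h 0 - F 0 (cnj h) + F 0 0) \<le> 8 * M / r\<^sup>2 * (norm h)\<^sup>2"
      using mixed_difference_bound[OF F r bnd, of h "cnj h"] by (simp add: power2_eq_square mult.assoc)
  qed
  moreover have d1: "((\<lambda>s. F s 0) has_derivative (*) (deriv (\<lambda>s. F s 0) 0)) (at 0)"
    using holomorphic_derivI[OF _ open_ball r0, of "\<lambda>s. F s 0"] F r0
    unfolding separately_holomorphic_def has_field_derivative_def by blast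
  moreover have "(F 0 has_derivative (*) (deriv (F 0) 0)) (at (cnj 0))"
    using holomorphic_derivI[OF _ open_ball r0, of "F 0"] F r0
    unfolding separately_holomorphic_def has_field_derivative_def by auto
  then have "((\<lambda>s. F 0 (cnj s)) has_derivative (\<lambda>h. deriv (F 0) 0 * cnj h)) (at 0)"
    by (rule has_derivative_compose[rotated]) (auto intro!: derivative_eq_intros)
  ultimately have "((\<lambda>s. (F s (cnj s) - F s 0 - F 0 (cnj s) + F 0 0) + F s 0 + F 0 (cnj s) - F 0 0)
      has_derivative (\<lambda>h. 0 + deriv (\<lambda>s. F s 0) 0 * h + deriv (F 0) 0 * cnj h - 0)) (at 0)"
    by (intro has_derivative_add has_derivative_diff has_derivative_const)
  then show ?thesis by simp
qed

text \<open>The difference quotients in the second variable are holomorphic in \<open>s\<close> and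
  converge uniformly in \<open>s\<close>, because the rate in
  \<open>Schwarz_difference_quotient\<close> sees only \<open>M\<close> and \<open>r\<close>. The
  bound on the derivative is Schwarz for \<open>F s t - F s 0\<close>.\<close>

lemma deriv_snd_holomorphic:
  assumes F: "separately_holomorphic F r" and r: "0 < r"
    and bnd: "\<And>s t. s \<in> ball 0 r \<Longrightarrow> t \<in> ball 0 r \<Longrightarrow> norm (F s t) < M"
  shows "(\<lambda>s. deriv (F s) 0) holomorphic_on ball 0 r"
    and "s \<in> ball 0 r \<Longrightarrow> norm (deriv (F s) 0) \<le> 2 * M / r"
proof -
  have r0: "0 \<in> ball 0 r" using r by simp
  have M: "0 < M" using bnd[OF r0 r0] by (smt (verit) norm_ge_zero)
  \<comment> \<open>The shift by 2 keeps every step strictly below \<open>r\<close>, including the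
    one for \<open>n = 0\<close>.\<close>
  define e where "e n = r / (real n + 2)" for n
  have e: "0 < e n" "e n < r" for n using r by (auto simp: e_def divide_simps)
  have e_lim: "e \<longlonglongrightarrow> 0" using LIMSEQ_ignore_initial_segment[OF lim_const_over_n[of r], of 2] by (simp add: e_def[abs_def] add.commute)
  define f where "f n s = (F s (of_real (e n)) - F s 0) / of_real (e n)" for n s
  have hf: "f n holomorphic_on ball 0 r" for n
    unfolding f_def using F r0 e[of n] unfolding separately_holomorphic_def
    by (intro holomorphic_intros) auto
  have err: "norm (f n s - deriv (F s) 0) \<le> 8 * M / r\<^sup>2 * e n" if "s \<in> ball 0 r" for n s
    unfolding f_def
    using Schwarz_difference_quotient[of "F s" r M "of_real (e n)"] F r bnd that e[of n]
    unfolding separately_holomorphic_def by auto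
  have ul: "uniform_limit (ball 0 r) f (\<lambda>s. deriv (F s) 0) sequentially"
  proof (rule uniform_limitI)
    fix d :: real assume "0 < d"
    have "(\<lambda>n. 8 * M / r\<^sup>2 * e n) \<longlonglongrightarrow> 0" using r by (auto intro!: tendsto_eq_intros e_lim)
    then have "\<forall>\<^sub>F n in sequentially. 8 * M / r\<^sup>2 * e n < d"
      using \<open>0 < d\<close> by (rule order_tendstoD)
    then show "\<forall>\<^sub>F n in sequentially. \<forall>x\<in>ball 0 r. dist (f n x) (deriv (F x) 0) < d"
      by eventually_elim (auto simp: dist_norm intro: le_less_trans[OF err])
  qed
  show "(\<lambda>s. deriv (F s) 0) holomorphic_on ball 0 r"
  proof (rule holomorphic_uniform_sequence[OF open_ball hf])
    fix x :: complex assume "x \<in> ball 0 r"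
    then obtain d where "0 < d" "cball x d \<subseteq> ball 0 r"
      using open_contains_cball_eq[OF open_ball] by blast
    with ul show "\<exists>d>0. cball x d \<subseteq> ball 0 r \<and>
        uniform_limit (cball x d) f (\<lambda>s. deriv (F s) 0) sequentially"
      using uniform_limit_on_subset by blast
  qed
  show "norm (deriv (F s) 0) \<le> 2 * M / r" if s: "s \<in> ball 0 r"
  proof -
    define g where "g = (\<lambda>t. F s t - F s 0)"
    have hol: "F s holomorphic_on ball 0 r" using F s by (simp add: separately_holomorphic_def)
    have "norm (deriv g 0) \<le> 2 * M / r"
    proof (rule Schwarz_bound(2)[OF _ _ r])
      show "g holomorphic_on ball 0 r" unfolding g_def by (intro holomorphic_intros hol)
      fix t :: complex assume "t \<in> ball 0 r"
      then show "norm (g t) < 2 * M"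
        using norm_triangle_ineq4[of "F s t" "F s 0"] bnd[OF s, of t] bnd[OF s r0] by (simp add: g_def)
    qed (simp add: g_def)
    moreover have "deriv g 0 = deriv (F s) 0"
      using holomorphic_derivI[OF hol open_ball r0]
      by (intro DERIV_imp_deriv) (auto simp: g_def intro!: derivative_eq_intros)
    ultimately show ?thesis by simp
  qed
qed

text \<open>The double quotient is a difference quotient in \<open>s\<close> of \<open>q h\<close>,
  which is close to the derivative \<open>G\<close>. It is compared with the same difference
  quotient of \<open>G\<close>, whose limit is \<open>deriv G 0\<close>.\<close>

lemma mixed_difference_quotient_tendsto:
  assumes F: "separately_holomorphic F r" and r: "0 < r"
    and bnd: "\<And>s t. s \<in> ball 0 r \<Longrightarrow> t \<in> ball 0 r \<Longrightarrow> norm (F s t) < M"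
  shows "((\<lambda>h::real. (F (of_real h) (of_real h) - F (of_real h) 0 - F 0 (of_real h) + F 0 0)
            / (of_real h * of_real h))
          \<longlongrightarrow> deriv (\<lambda>s. deriv (F s) 0) 0) (at_right 0)"
proof -
  have r0: "0 \<in> ball 0 r" using r by simp
  have M: "0 < M" using bnd[OF r0 r0] by (smt (verit) norm_ge_zero)
  define G where "G = (\<lambda>s. deriv (F s) 0)"
  define q where "q h s = (F s (of_real h) - F s 0) / of_real h" for h :: real and s
  note G = deriv_snd_holomorphic[OF F r bnd, folded G_def]
  define L where "L h = (q h (of_real h) - q h 0) / of_real h" for h :: real
  have L_eq: "(F (of_real h) (of_real h) - F (of_real h) 0 - F 0 (of_real h) + F 0 0)
            / (of_real h * of_real h) = L h" for h :: real
    by (simp add: L_def q_def diff_divide_distrib add_divide_distrib)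
  have Gd: "(G has_field_derivative deriv G 0) (at 0)"
    by (rule holomorphic_derivI[OF G(1) open_ball r0])
  then have "((\<lambda>h. (G h - G 0) / h) \<longlongrightarrow> deriv G 0) (at 0)"
    by (simp add: has_field_derivative_iff)
  moreover have "filterlim (\<lambda>h::real. complex_of_real h) (at 0) (at_right 0)"
    unfolding filterlim_at
    by (auto intro!: tendsto_eq_intros simp: eventually_at_filter)
  ultimately have lim: "((\<lambda>h::real. (G (of_real h) - G 0) / of_real h) \<longlongrightarrow> deriv G 0) (at_right 0)"
    by (rule filterlim_compose)
  have "((\<lambda>h::real. L h - (G (of_real h) - G 0) / of_real h) \<longlongrightarrow> 0) (at_right 0)"
  proof (rule Lim_null_comparison)
    show "((\<lambda>h::real. 24 * M / r\<^sup>2 / r * h) \<longlongrightarrow> 0) (at_right 0)"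
      using r by (auto intro!: tendsto_eq_intros)
    show "\<forall>\<^sub>F h in at_right (0::real).
        norm (L h - (G (of_real h) - G 0) / of_real h) \<le> 24 * M / r\<^sup>2 / r * h"
      unfolding eventually_at_right_field
    proof (intro exI conjI allI impI)
      fix h :: real assume "0 < h" "h < r"
      then have h: "of_real h \<in> ball (0::complex) r" "complex_of_real h \<noteq> 0" by auto
      \<comment> \<open>The error \<open>q h - G\<close> is of order \<open>h\<close> uniformly in
        \<open>s\<close>. Subtracting its value at 0 lets Schwarz gain a factor
        \<open>norm s\<close>, so that at \<open>s = h\<close> the error is of order
        \<open>h * h\<close> and survives the division by \<open>h\<close>.\<close>
      define D where "D = (\<lambda>s. (q h s - G s) - (q h 0 - G 0))"
      have qG: "norm (q h s - G s) \<le> 8 * M / r\<^sup>2 * h" if "s \<in> ball 0 r" for s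
        unfolding q_def G_def
        using Schwarz_difference_quotient[of "F s" r M "of_real h"] F r bnd that h \<open>0 < h\<close>
        unfolding separately_holomorphic_def by auto
      have "norm (D (of_real h)) \<le> (24 * M / r\<^sup>2 * h) / r * norm (complex_of_real h)"
      proof (rule Schwarz_bound(1)[OF _ _ r _ h(1)])
        show "D holomorphic_on ball 0 r"
          unfolding D_def q_def using F h r0 unfolding separately_holomorphic_def
          by (intro holomorphic_intros G(1)) auto
        fix s :: complex assume s: "s \<in> ball 0 r"
        have "norm (D s) \<le> 8 * M / r\<^sup>2 * h + 8 * M / r\<^sup>2 * h"
          unfolding D_def
          using norm_triangle_ineq4[of "q h s - G s" "q h 0 - G 0"] qG[OF s] qG[OF r0] by linarith
        also have "\<dots> < 24 * M / r\<^sup>2 * h" using M r \<open>0 < h\<close> by (simp add: field_simps)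
        finally show "norm (D s) < 24 * M / r\<^sup>2 * h" .
      qed (simp add: D_def)
      moreover have "L h - (G (of_real h) - G 0) / of_real h = D (of_real h) / of_real h"
        by (simp add: L_def D_def diff_divide_distrib)
      ultimately show "norm (L h - (G (of_real h) - G 0) / of_real h) \<le> 24 * M / r\<^sup>2 / r * h"
        using \<open>0 < h\<close> by (simp add: norm_divide field_simps)
    qed (use r in auto)
  qed
  from tendsto_add[OF this lim] show ?thesis
    unfolding L_eq G_def[symmetric] by simp
qed

section \<open>Coordinate slices and Wirtinger derivatives\<close>

lemma linear_axis: "linear (axis i :: 'a::real_vector \<Rightarrow> 'a ^ 'n)"
  by (rule linearI) (auto simp: axis_def vec_eq_iff)

lemma norm_axis_complex [simp]: "norm (axis i x :: complex ^ 'n) = norm x"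
  by (simp add: norm_eq_sqrt_inner inner_axis_axis)

lemma axis_zero [simp]: "axis i (0 :: 'a::zero) = 0"
  by (simp add: axis_def vec_eq_iff)

lemma has_derivative_axis [derivative_intros]:
  "(f has_derivative f') F \<Longrightarrow>
    ((\<lambda>x. axis i (f x) :: complex ^ 'n) has_derivative (\<lambda>h. axis i (f' h))) F"
  by (rule bounded_linear.has_derivative[OF linear_conv_bounded_linear[THEN iffD1, OF linear_axis]])

lemma sum_UNIV_option:
  fixes f :: "'n::finite option \<Rightarrow> 'b::comm_monoid_add"
  shows "sum f UNIV = f None + (\<Sum>i\<in>UNIV. f (Some i))"
  by (simp add: UNIV_option_conv sum.reindex)

text \<open>These weights turn values at a base point and its shifted neighbours into one value and
  forward difference quotients, a discrete version of a first-order jet.\<close>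

lemma sum_UNIV_option_difference_stencil:
  fixes f :: "'n::finite option \<Rightarrow> complex"
  shows "(\<Sum>a\<in>UNIV. f a * (case a of None \<Rightarrow> x - (\<Sum>i\<in>UNIV. v i / h) | Some i \<Rightarrow> v i / h))
    = f None * x + (\<Sum>i\<in>UNIV. (f (Some i) - f None) / h * v i)"
  by (simp add: sum_UNIV_option algebra_simps diff_divide_distrib sum_subtractf sum_distrib_left)

lemma holomorphic_several_slice:
  assumes f: "holomorphic_several_on f \<Omega>" and S: "\<And>s. s \<in> S \<Longrightarrow> u + axis j s \<in> \<Omega>"
  shows "(\<lambda>s. f (u + axis j s)) holomorphic_on S"
  unfolding holomorphic_on_def
proof
  fix s assume "s \<in> S"
  then obtain D where D: "(f has_derivative (\<lambda>h. \<Sum>k\<in>UNIV. D $ k * h $ k)) (at (u + axis j s))"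
    using f S unfolding holomorphic_several_on_def by blast
  have "((\<lambda>s. f (u + axis j s)) has_derivative
      (\<lambda>h. \<Sum>k\<in>UNIV. D $ k * (axis j h) $ k)) (at s)"
    by (rule has_derivative_compose[where f = "\<lambda>s. u + axis j s" and x = s, OF _ D]) (auto intro!: derivative_eq_intros)
  moreover have "(\<Sum>k\<in>UNIV. D $ k * (axis j h) $ k) = D $ j * h" for h
    by (simp add: axis_def if_distrib cong: if_cong)
  ultimately have "((\<lambda>s. f (u + axis j s)) has_field_derivative D $ j) (at s)"
    by (simp add: has_field_derivative_def)
  then show "(\<lambda>s. f (u + axis j s)) field_differentiable at s within S"
    using field_differentiable_at_within field_differentiable_def by blast
qed

lemma antiholomorphic_several_slice:
  assumes f: "holomorphic_several_on (\<lambda>u. cnj (f u)) \<Omega>" and "open S"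
    and S: "\<And>s. s \<in> S \<Longrightarrow> u + axis j (cnj s) \<in> \<Omega>"
  shows "(\<lambda>s. f (u + axis j (cnj s))) holomorphic_on S"
proof -
  have "(\<lambda>s. cnj (f (u + axis j s))) holomorphic_on cnj ` S"
    by (rule holomorphic_several_slice[OF f]) (use S in auto)
  from holomorphic_on_compose_cnj_cnj[OF this \<open>open S\<close>]
  show ?thesis by (simp add: o_def)
qed

lemma directional_deriv_slice:
  assumes "((\<lambda>s. f (u + axis j s)) has_derivative (\<lambda>h. p * h + q * cnj h)) (at 0)"
  shows "directional_deriv f (axis j v) u = p * v + q * cnj v"
proof -
  have "((\<lambda>s. f (u + axis j s)) has_derivative (\<lambda>h. p * h + q * cnj h)) (at (0 *\<^sub>R v))"
    using assms by simp
  then have "((\<lambda>t. f (u + axis j (t *\<^sub>R v))) has_derivative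
      (\<lambda>t. p * (t *\<^sub>R v) + q * cnj (t *\<^sub>R v))) (at 0)"
    by (rule has_derivative_compose[rotated]) (auto intro!: derivative_eq_intros)
  moreover have "axis j (t *\<^sub>R v) = t *\<^sub>R (axis j v :: complex ^ _)" for t
    by (simp add: axis_def vec_eq_iff)
  ultimately have "((\<lambda>t. f (u + t *\<^sub>R axis j v)) has_vector_derivative p * v + q * cnj v) (at 0)"
    by (simp add: has_vector_derivative_def scaleR_add_right)
  then show ?thesis
    unfolding directional_deriv_def by (rule vector_derivative_at)
qed

lemma wirtinger_bar_None [simp]: "wirtinger_bar None f = f"
  by (rule ext) simp

text \<open>The directions 1 and \<open>\<i>\<close> give the derivatives \<open>p + q\<close> and
  \<open>\<i> * (p - q)\<close>; the Wirtinger combinations solve for \<open>p\<close> and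
  \<open>q\<close>.\<close>

lemma wirtinger_slice:
  assumes "((\<lambda>s. f (u + axis j s)) has_derivative (\<lambda>h. p * h + q * cnj h)) (at 0)"
  shows "wirtinger (Some j) f u = p" and "wirtinger_bar (Some j) f u = q"
  by (simp_all add: directional_deriv_slice[OF assms] algebra_simps)

section \<open>Gram forms, Hermitian symmetry and local boundedness\<close>

locale sesquiholomorphic_kernel =
  fixes \<Omega> :: "(complex ^ 'm) set" and K :: "complex ^ 'm \<Rightarrow> complex ^ 'm \<Rightarrow> complex"
  assumes open_domain: "open \<Omega>"
    and sesquiholomorphic: "sesquiholomorphic_on K \<Omega>"
    and nonneg_definite: "nonneg_definite_kernel_on K \<Omega>"
    and diagonal_pos: "u \<in> \<Omega> \<Longrightarrow> 0 < Re (K u u)"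
    and diagonal_continuous: "continuous_on \<Omega> (\<lambda>u. K u u)"
begin

text \<open>Passes from finite sets to indexed families with possible repetitions: the weights at
  coinciding points are added up in \<open>C\<close>.\<close>

lemma gram_nonneg:
  assumes "finite A" and p: "p ` A \<subseteq> \<Omega>"
  shows "(\<Sum>a\<in>A. \<Sum>b\<in>A. cnj (c a) * K (p a) (p b) * c b) \<in> \<real> \<and>
    0 \<le> Re (\<Sum>a\<in>A. \<Sum>b\<in>A. cnj (c a) * K (p a) (p b) * c b)"
proof -
  define C where "C z = (\<Sum>a | a \<in> A \<and> p a = z. c a)" for z
  have "(\<Sum>a\<in>A. \<Sum>b\<in>A. cnj (c a) * K (p a) (p b) * c b)
      = (\<Sum>z\<in>p ` A. \<Sum>a | a \<in> A \<and> p a = z. \<Sum>w\<in>p ` A. \<Sum>b | b \<in> A \<and> p b = w.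
          cnj (c a) * K (p a) (p b) * c b)"
    by (subst sum.image_gen[OF \<open>finite A\<close>, of _ p], rule sum.cong[OF refl], rule sum.cong[OF refl],
        rule sum.image_gen[OF \<open>finite A\<close>])
  also have "\<dots> = (\<Sum>z\<in>p ` A. \<Sum>w\<in>p ` A. cnj (C z) * K z w * C w)"
  proof (rule sum.cong[OF refl])
    fix z
    have "(\<Sum>a | a \<in> A \<and> p a = z. \<Sum>w\<in>p ` A. \<Sum>b | b \<in> A \<and> p b = w.
          cnj (c a) * K (p a) (p b) * c b)
        = (\<Sum>w\<in>p ` A. \<Sum>a | a \<in> A \<and> p a = z. \<Sum>b | b \<in> A \<and> p b = w.
          cnj (c a) * K z w * c b)"
      by (subst sum.swap) (auto intro!: sum.cong)
    also have "\<dots> = (\<Sum>w\<in>p ` A. cnj (C z) * K z w * C w)"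
      by (simp add: C_def sum_distrib_left sum_distrib_right)
        (intro sum.cong refl sum.swap)
    finally show "(\<Sum>a | a \<in> A \<and> p a = z. \<Sum>w\<in>p ` A. \<Sum>b | b \<in> A \<and> p b = w.
          cnj (c a) * K (p a) (p b) * c b) = (\<Sum>w\<in>p ` A. cnj (C z) * K z w * C w)" .
  qed
  finally show ?thesis
    using nonneg_definite assms unfolding nonneg_definite_kernel_on_def by simp
qed

lemma diagonal_real: "u \<in> \<Omega> \<Longrightarrow> K u u = of_real (Re (K u u))"
  using gram_nonneg[of "{()}" "\<lambda>_. u" "\<lambda>_. 1"] by (simp add: complex_is_Real_iff complex_eq_iff)

text \<open>The form with weights 1 at \<open>z\<close> and \<open>y\<close> at \<open>w\<close> is
  real. Taking \<open>y = 1\<close> compares imaginary parts of \<open>K z w\<close> and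
  \<open>K w z\<close>, and \<open>y = \<i>\<close> compares real parts.\<close>

lemma hermitian:
  assumes "z \<in> \<Omega>" "w \<in> \<Omega>"
  shows "K w z = cnj (K z w)"
proof -
  have G: "(\<Sum>a\<in>{True, False}. \<Sum>b\<in>{True, False}.
      cnj (if a then 1 else y) * K (if a then z else w) (if b then z else w) * (if b then 1 else y)) \<in> \<real>" for y
    using gram_nonneg[of "{True, False}" "\<lambda>a. if a then z else w" "\<lambda>a. if a then 1 else y"] assms by auto
  have "Im (K z z) = 0" "Im (K w w) = 0"
    using diagonal_real[of z] diagonal_real[of w] assms by (metis Im_complex_of_real)+
  then show ?thesis
    using G[of 1] G[of \<i>] by (simp add: complex_is_Real_iff complex_eq_iff)
qed

text \<open>The point \<open>z\<close> is adjoined to the family with the weight \<open>x\<close>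
  that minimizes the enlarged Gram form; the minimum is \<open>Q\<close> minus
  \<open>(norm S)\<^sup>2 / k\<close>, and it is nonnegative.\<close>

lemma gram_Cauchy_Schwarz:
  assumes "finite A" and p: "p ` A \<subseteq> \<Omega>" and z: "z \<in> \<Omega>"
  shows "(norm (\<Sum>b\<in>A. K z (p b) * c b))\<^sup>2
    \<le> Re (K z z) * Re (\<Sum>a\<in>A. \<Sum>b\<in>A. cnj (c a) * K (p a) (p b) * c b)"
proof -
  define S where "S = (\<Sum>b\<in>A. K z (p b) * c b)"
  define Q where "Q = (\<Sum>a\<in>A. \<Sum>b\<in>A. cnj (c a) * K (p a) (p b) * c b)"
  define k where "k = Re (K z z)"
  define x where "x = - S / of_real k"
  have k: "0 < k" "K z z = of_real k"
    using diagonal_pos[OF z] diagonal_real[OF z] by (auto simp: k_def)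
  \<comment> \<open>The index \<open>None\<close> keeps \<open>z\<close> apart from the family even
    if \<open>z\<close> already occurs among the \<open>p b\<close>.\<close>
  define P where "P = (\<lambda>a. case a of None \<Rightarrow> z | Some b \<Rightarrow> p b)"
  define C where "C = (\<lambda>a. case a of None \<Rightarrow> x | Some b \<Rightarrow> c b)"
  have sums: "sum f (insert None (Some ` A)) = f None + (\<Sum>b\<in>A. f (Some b))"
    for f :: "'a option \<Rightarrow> complex"
    using \<open>finite A\<close> by (simp add: sum.reindex)
  have S': "(\<Sum>a\<in>A. cnj (c a) * K (p a) z) = cnj S"
    using p z unfolding S_def by (auto simp: hermitian[of z] mult.commute intro!: sum.cong)
  have "(\<Sum>a\<in>insert None (Some ` A). \<Sum>b\<in>insert None (Some ` A). cnj (C a) * K (P a) (P b) * C b)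
      = cnj x * of_real k * x + cnj x * S + cnj S * x + Q"
    unfolding S'[symmetric] unfolding sums C_def P_def
    by (simp add: k S_def Q_def sum.distrib sum_distrib_left sum_distrib_right mult.assoc)
  moreover have "0 \<le> Re (\<Sum>a\<in>insert None (Some ` A). \<Sum>b\<in>insert None (Some ` A).
      cnj (C a) * K (P a) (P b) * C b)"
    by (rule gram_nonneg[THEN conjunct2]) (use p z assms(1) in \<open>auto simp: P_def\<close>)
  ultimately have "0 \<le> Re (cnj x * of_real k * x + cnj x * S + cnj S * x + Q)" by simp
  also have "cnj x * of_real k * x + cnj x * S + cnj S * x + Q = Q - of_real ((norm S)\<^sup>2 / k)"
    using k(1) complex_norm_square[of S] by (simp add: x_def field_simps)
  finally have "(norm S)\<^sup>2 \<le> k * Re Q" using k(1) by (simp add: field_simps)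
  then show ?thesis unfolding S_def Q_def k_def .
qed

lemma norm_kernel_le:
  assumes "z \<in> \<Omega>" "u \<in> \<Omega>"
  shows "(norm (K z u))\<^sup>2 \<le> Re (K z z) * Re (K u u)"
  using gram_Cauchy_Schwarz[of "{()}" "\<lambda>_. u" z "\<lambda>_. 1"] assms by simp

text \<open>Off-diagonal values are controlled by the diagonal, which is continuous. The factor 3
  leaves room for two successive coordinate shifts of length less than \<open>r\<close>.\<close>

lemma locally_bounded:
  assumes w: "w \<in> \<Omega>"
  obtains r M where "0 < r" "ball w (3 * r) \<subseteq> \<Omega>"
    "\<And>z u. z \<in> ball w (3 * r) \<Longrightarrow> u \<in> ball w (3 * r) \<Longrightarrow> norm (K z u) < M"
proof -
  define N where "N = Re (K w w) + 1"
  have N: "0 < N" using diagonal_pos[OF w] by (simp add: N_def)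
  have "isCont (\<lambda>u. Re (K u u)) w"
    using diagonal_continuous w open_domain
    by (auto simp: continuous_on_eq_continuous_at intro!: continuous_intros)
  then have "\<forall>\<^sub>F u in at w. Re (K u u) < N"
    unfolding isCont_def by (rule order_tendstoD) (simp add: N_def)
  then obtain d where "0 < d" "\<And>u. u \<noteq> w \<Longrightarrow> dist u w < d \<Longrightarrow> Re (K u u) < N"
    unfolding eventually_at by auto
  then have d: "0 < d" "\<And>u. u \<in> ball w d \<Longrightarrow> Re (K u u) < N"
    by (auto simp: N_def dist_commute) (metis N_def dist_commute less_add_one)
  obtain e where e: "0 < e" "ball w e \<subseteq> \<Omega>" using open_domain w openE by blast
  define r where "r = min d e / 3"
  have r: "0 < r" "ball w (3 * r) \<subseteq> ball w d" "ball w (3 * r) \<subseteq> \<Omega>"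
    using d e by (auto simp: r_def)
  have "norm (K z u) < N + 1" if "z \<in> ball w (3 * r)" "u \<in> ball w (3 * r)" for z u
  proof -
    have zu: "z \<in> \<Omega>" "u \<in> \<Omega>" "Re (K z z) < N" "Re (K u u) < N" using that r d by blast+
    have "(norm (K z u))\<^sup>2 \<le> Re (K z z) * Re (K u u)" by (rule norm_kernel_le) fact+
    also have "\<dots> \<le> N * N"
      using zu diagonal_pos[of z] diagonal_pos[of u] by (intro mult_mono) auto
    finally have "norm (K z u) \<le> N"
      using N by (auto intro: power2_le_imp_le[of _ N] simp: power2_eq_square)
    then show ?thesis by simp
  qed
  with r that show ?thesis by blast
qed

section \<open>First and mixed derivatives of the kernel\<close>

lemma slice_separately_holomorphic:
  assumes "\<And>s. s \<in> ball 0 r \<Longrightarrow> z + axis j s \<in> \<Omega>" "\<And>s. s \<in> ball 0 r \<Longrightarrow> u + axis i s \<in> \<Omega>"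
  shows "separately_holomorphic (\<lambda>s t. K (z + axis j s) (u + axis i (cnj t))) r"
  using sesquiholomorphic assms unfolding separately_holomorphic_def sesquiholomorphic_on_def
  by (auto intro!: holomorphic_several_slice[where \<Omega> = \<Omega>] antiholomorphic_several_slice[where \<Omega> = \<Omega>])

text \<open>The conjugated parameter turns the derivative in the conjugate of the
  \<open>i\<close>-th coordinate into an ordinary complex derivative;
  \<open>wirtinger_bar_snd\<close> identifies it with the Wirtinger derivative.\<close>

definition dbar :: "'m \<Rightarrow> complex ^ 'm \<Rightarrow> complex ^ 'm \<Rightarrow> complex" where
  "dbar i z u = deriv (\<lambda>t. K z (u + axis i (cnj t))) 0"

definition ddbar :: "'m \<Rightarrow> 'm \<Rightarrow> complex ^ 'm \<Rightarrow> complex" where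
  "ddbar j i w = deriv (\<lambda>s. dbar i (w + axis j s) w) 0"

lemma snd_has_dbar:
  assumes "z \<in> \<Omega>" "u \<in> \<Omega>"
  shows "((\<lambda>t. K z (u + axis i (cnj t))) has_field_derivative dbar i z u) (at 0)"
proof -
  obtain e where e: "0 < e" "ball u e \<subseteq> \<Omega>" using open_domain assms openE by blast
  have "(\<lambda>t. K z (u + axis i (cnj t))) holomorphic_on ball 0 e"
    using sesquiholomorphic assms e unfolding sesquiholomorphic_on_def
    by (intro antiholomorphic_several_slice[where \<Omega> = \<Omega>]) (auto simp: subset_iff dist_norm)
  from holomorphic_derivI[OF this open_ball, of 0] e show ?thesis by (simp add: dbar_def)
qed

text \<open>Hermitian symmetry makes a slice in the first variable the slice in the second one,
  conjugated inside and outside.\<close>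

lemma fst_has_cnj_dbar:
  assumes "z \<in> \<Omega>" "u \<in> \<Omega>"
  shows "((\<lambda>s. K (u + axis i s) z) has_field_derivative cnj (dbar i z u)) (at 0)"
proof -
  obtain e where e: "0 < e" "ball u e \<subseteq> \<Omega>" using open_domain assms openE by blast
  have "(cnj \<circ> (\<lambda>t. K z (u + axis i (cnj t))) \<circ> cnj has_field_derivative cnj (dbar i z u)) (at 0)"
    by (rule has_field_derivative_cnj_cnj) (simp add: snd_has_dbar assms)
  then show ?thesis
  proof (rule has_field_derivative_transform_within_open[of _ _ _ "ball 0 e"])
    fix s :: complex assume "s \<in> ball 0 e"
    then have "u + axis i s \<in> \<Omega>" using e by (auto simp: subset_iff dist_norm)
    then show "(cnj \<circ> (\<lambda>t. K z (u + axis i (cnj t))) \<circ> cnj) s = K (u + axis i s) z"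
      using hermitian[of "u + axis i s" z] assms by simp
  qed (use e in auto)
qed

lemma wirtinger_bar_snd:
  assumes "z \<in> \<Omega>" "u \<in> \<Omega>"
  shows "wirtinger_bar (Some i) (\<lambda>u. K z u) u = dbar i z u"
proof (rule wirtinger_slice(2)[where p = 0])
  have "((\<lambda>t. K z (u + axis i (cnj t))) has_derivative (*) (dbar i z u)) (at (cnj 0))"
    using snd_has_dbar[OF assms] by (simp add: has_field_derivative_def)
  then have "((\<lambda>s. K z (u + axis i (cnj (cnj s)))) has_derivative (\<lambda>h. dbar i z u * cnj h)) (at 0)"
    by (rule has_derivative_compose[rotated]) (auto intro!: derivative_eq_intros)
  then show "((\<lambda>s. K z (u + axis i s)) has_derivative (\<lambda>h. 0 * h + dbar i z u * cnj h)) (at 0)"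
    by simp
qed

section \<open>Wirtinger derivatives of powers of the diagonal\<close>

text \<open>The diagonal of \<open>K\<close> along a slice has the form \<open>F s (cnj s)\<close>,
  so \<open>separately_holomorphic_conj_diagonal\<close> gives its real derivative; the chain rule
  for \<open>powr\<close> does the rest.\<close>

lemma diag_power_slice:
  assumes u: "u \<in> \<Omega>"
  shows "((\<lambda>s. diag_power K \<alpha> (u + axis j s)) has_derivative
    (\<lambda>h. of_real (\<alpha> * Re (K u u) powr (\<alpha> - 1)) * cnj (dbar j u u) * h
        + of_real (\<alpha> * Re (K u u) powr (\<alpha> - 1)) * dbar j u u * cnj h)) (at 0)"
proof -
  obtain r M where r: "0 < r" "ball u (3 * r) \<subseteq> \<Omega>" and
    M: "\<And>z y. z \<in> ball u (3 * r) \<Longrightarrow> y \<in> ball u (3 * r) \<Longrightarrow> norm (K z y) < M"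
    by (rule locally_bounded[OF u]) blast
  have in_ball: "u + axis j s \<in> ball u (3 * r)" if "s \<in> ball 0 r" for s
    using that r(1) by (simp add: dist_norm)
  define F where "F = (\<lambda>s t. K (u + axis j s) (u + axis j (cnj t)))"
  have "separately_holomorphic F r"
    unfolding F_def by (rule slice_separately_holomorphic) (use in_ball r in auto)
  from separately_holomorphic_conj_diagonal[OF this r(1), of M]
  have "((\<lambda>s. F s (cnj s)) has_derivative
      (\<lambda>h. deriv (\<lambda>s. F s 0) 0 * h + deriv (F 0) 0 * cnj h)) (at 0)"
    using M in_ball by (force simp: F_def)
  moreover have "deriv (F 0) 0 = dbar j u u" by (simp add: F_def dbar_def)
  moreover have "deriv (\<lambda>s. F s 0) 0 = cnj (dbar j u u)"
    using DERIV_imp_deriv[OF fst_has_cnj_dbar[OF u u]] by (simp add: F_def)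
  ultimately have d: "((\<lambda>s. K (u + axis j s) (u + axis j s)) has_derivative
      (\<lambda>h. cnj (dbar j u u) * h + dbar j u u * cnj h)) (at 0)"
    by (simp add: F_def)
  \<comment> \<open>The two terms of the derivative are conjugate to each other, so passing through
    \<open>Re\<close> loses nothing.\<close>
  have real: "of_real (Re (cnj b * h + b * cnj h)) = cnj b * h + b * cnj h" for b h :: complex
    by (simp add: complex_eq_iff)
  have k: "0 < Re (K u u)" by (rule diagonal_pos[OF u])
  have "((\<lambda>s. Re (K (u + axis j s) (u + axis j s)) powr \<alpha>) has_derivative
      (\<lambda>h. Re (K u u) powr \<alpha> * (0 * ln (Re (K u u)) +
          Re (cnj (dbar j u u) * h + dbar j u u * cnj h) * \<alpha> / Re (K u u)))) (at 0)"
    using has_derivative_powr[OF has_derivative_Re[OF d] has_derivative_const[where c = \<alpha>]] k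
    by simp
  then have "((\<lambda>s. diag_power K \<alpha> (u + axis j s)) has_derivative
      (\<lambda>h. of_real (Re (K u u) powr \<alpha> * (0 * ln (Re (K u u)) +
          Re (cnj (dbar j u u) * h + dbar j u u * cnj h) * \<alpha> / Re (K u u))))) (at 0)"
    unfolding diag_power_def by (rule has_derivative_of_real)
  moreover have "of_real (Re (K u u) powr \<alpha> * (0 * ln (Re (K u u)) +
          Re (cnj (dbar j u u) * h + dbar j u u * cnj h) * \<alpha> / Re (K u u)))
      = of_real (\<alpha> * Re (K u u) powr (\<alpha> - 1)) * cnj (dbar j u u) * h
        + of_real (\<alpha> * Re (K u u) powr (\<alpha> - 1)) * dbar j u u * cnj h" for h
  proof -
    have "of_real (Re (K u u) powr \<alpha> * (0 * ln (Re (K u u)) +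
          Re (cnj (dbar j u u) * h + dbar j u u * cnj h) * \<alpha> / Re (K u u)))
       = of_real (\<alpha> * Re (K u u) powr (\<alpha> - 1)) *
          complex_of_real (Re (cnj (dbar j u u) * h + dbar j u u * cnj h))"
      unfolding of_real_mult[symmetric] using k by (simp add: powr_diff)
    then show ?thesis unfolding real by (simp add: distrib_left mult.assoc)
  qed
  ultimately show ?thesis by simp
qed

text \<open>Both arguments of \<open>dbar\<close> move, so it is treated like \<open>K\<close>
  itself: as a function of two parameters it is separately holomorphic and bounded. The coefficient
  \<open>q\<close> stays unspecified, since the outer derivative reads off only the coefficient of
  \<open>h\<close>.\<close>

lemma dbar_slice:
  assumes w: "w \<in> \<Omega>"
  shows "\<exists>q. ((\<lambda>s. dbar i (w + axis j s) (w + axis j s)) has_derivative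
    (\<lambda>h. ddbar j i w * h + q * cnj h)) (at 0)"
proof -
  obtain r M where r: "0 < r" "ball w (3 * r) \<subseteq> \<Omega>" and
    M: "\<And>z y. z \<in> ball w (3 * r) \<Longrightarrow> y \<in> ball w (3 * r) \<Longrightarrow> norm (K z y) < M"
    by (rule locally_bounded[OF w]) blast
  have "w + axis j s \<in> ball w (3 * r)" if "s \<in> ball 0 r" for s
    using that r(1) by (simp add: dist_norm)
  moreover have "w + axis j s + axis i t \<in> ball w (3 * r)" if "s \<in> ball 0 r" "t \<in> ball 0 r" for s t
    using that r(1) norm_triangle_ineq4[of "- axis j s :: complex ^ 'm" "axis i t"]
    by (simp add: dist_norm)
  ultimately have in_ball:
    "\<And>s. s \<in> ball 0 r \<Longrightarrow> w + axis j s \<in> ball w (3 * r)"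
    "\<And>s t. s \<in> ball 0 r \<Longrightarrow> t \<in> ball 0 r \<Longrightarrow> w + axis j s + axis i t \<in> ball w (3 * r)"
    by blast+
  have in_dom:
    "\<And>s. s \<in> ball 0 r \<Longrightarrow> w + axis j s \<in> \<Omega>"
    "\<And>s t. s \<in> ball 0 r \<Longrightarrow> t \<in> ball 0 r \<Longrightarrow> w + axis j s + axis i t \<in> \<Omega>"
    using in_ball r(2) by blast+
  define P where "P = (\<lambda>s t. dbar i (w + axis j s) (w + axis j (cnj t)))"
  have "separately_holomorphic P r"
    unfolding separately_holomorphic_def
  proof (intro conjI ballI)
    fix t :: complex assume t: "t \<in> ball 0 r"
    have "(\<lambda>s. deriv ((\<lambda>s t'. K (w + axis j s) (w + axis j (cnj t) + axis i (cnj t'))) s) 0)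
        holomorphic_on ball 0 r"
      by (rule deriv_snd_holomorphic(1)[where M = M], rule slice_separately_holomorphic)
        (use in_ball in_dom r(1) M t in auto)
    then show "(\<lambda>s. P s t) holomorphic_on ball 0 r" by (simp add: P_def dbar_def)
  next
    fix s :: complex assume s: "s \<in> ball 0 r"
    \<comment> \<open>For fixed \<open>s\<close>, both parameters act on the second argument of
      \<open>K\<close>: \<open>t\<close> moves the base point and \<open>t'\<close> is the variable
      of differentiation.\<close>
    have "separately_holomorphic
        (\<lambda>t t'. K (w + axis j s) (w + axis j (cnj t) + axis i (cnj t'))) r"
      unfolding separately_holomorphic_def
    proof (intro conjI ballI)
      fix t' :: complex assume t': "t' \<in> ball 0 r"
      have "(\<lambda>t. K (w + axis j s) (w + axis i (cnj t') + axis j (cnj t))) holomorphic_on ball 0 r"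
        using sesquiholomorphic in_dom s t' unfolding sesquiholomorphic_on_def
        by (intro antiholomorphic_several_slice[where \<Omega> = \<Omega>]) (auto simp: add_ac)
      then show "(\<lambda>t. K (w + axis j s) (w + axis j (cnj t) + axis i (cnj t'))) holomorphic_on ball 0 r"
        by (simp add: add_ac)
    next
      fix t :: complex assume "t \<in> ball 0 r"
      then show "(\<lambda>t'. K (w + axis j s) (w + axis j (cnj t) + axis i (cnj t'))) holomorphic_on ball 0 r"
        using sesquiholomorphic in_dom s unfolding sesquiholomorphic_on_def
        by (intro antiholomorphic_several_slice[where \<Omega> = \<Omega>]) auto
    qed
    from deriv_snd_holomorphic(1)[OF this r(1), of M]
    show "P s holomorphic_on ball 0 r" using M in_ball s by (simp add: P_def dbar_def)
  qed
  moreover have "norm (P s t) < 2 * M / r + 1" if "s \<in> ball 0 r" "t \<in> ball 0 r" for s t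
  proof -
    have "norm (deriv ((\<lambda>s t'. K (w + axis j s) (w + axis j (cnj t) + axis i (cnj t'))) s) 0)
        \<le> 2 * M / r"
      by (rule deriv_snd_holomorphic(2)[where M = M], rule slice_separately_holomorphic)
        (use in_ball in_dom r(1) M that in auto)
    then show ?thesis by (simp add: P_def dbar_def)
  qed
  ultimately have "((\<lambda>s. P s (cnj s)) has_derivative
      (\<lambda>h. deriv (\<lambda>s. P s 0) 0 * h + deriv (P 0) 0 * cnj h)) (at 0)"
    using r(1) by (intro separately_holomorphic_conj_diagonal)
  then show ?thesis by (auto simp: P_def ddbar_def)
qed

lemma wirtinger_bar_diag_power:
  assumes "u \<in> \<Omega>"
  shows "wirtinger_bar (Some i) (diag_power K \<alpha>) u = of_real \<alpha> * diag_power K (\<alpha> - 1) u * dbar i u u"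
  by (subst wirtinger_slice(2)[OF diag_power_slice[OF assms]]) (simp add: diag_power_def)

lemma wirtinger_diag_power:
  assumes "u \<in> \<Omega>"
  shows "wirtinger (Some j) (diag_power K \<alpha>) u
    = of_real \<alpha> * diag_power K (\<alpha> - 1) u * cnj (dbar j u u)"
  by (subst wirtinger_slice(1)[OF diag_power_slice[OF assms]]) (simp add: diag_power_def)

text \<open>The formula for the inner derivative holds on a whole ball around \<open>w\<close>, so
  it may replace that derivative before the product rule is applied to a power of the diagonal times
  \<open>dbar\<close>.\<close>

lemma wirtinger_wirtinger_bar_diag_power:
  assumes w: "w \<in> \<Omega>"
  shows "wirtinger (Some j) (wirtinger_bar (Some i) (diag_power K \<alpha>)) w
    = of_real \<alpha> * (of_real (\<alpha> - 1) * diag_power K (\<alpha> - 2) w * cnj (dbar j w w) * dbar i w w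
        + diag_power K (\<alpha> - 1) w * ddbar j i w)"
proof -
  obtain e where e: "0 < e" "ball w e \<subseteq> \<Omega>" using open_domain w openE by blast
  obtain q where q: "((\<lambda>s. dbar i (w + axis j s) (w + axis j s)) has_derivative
    (\<lambda>h. ddbar j i w * h + q * cnj h)) (at 0)"
    using dbar_slice[OF w] by blast
  define a where "a = complex_of_real ((\<alpha> - 1) * Re (K w w) powr (\<alpha> - 1 - 1))"
  have "((\<lambda>s. of_real \<alpha> * (diag_power K (\<alpha> - 1) (w + axis j s) * dbar i (w + axis j s) (w + axis j s)))
      has_derivative (\<lambda>h. of_real \<alpha> * (diag_power K (\<alpha> - 1) (w + axis j 0) * (ddbar j i w * h + q * cnj h)
        + (a * cnj (dbar j w w) * h + a * dbar j w w * cnj h) * dbar i (w + axis j 0) (w + axis j 0)))) (at 0)"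
    unfolding a_def
    by (intro has_derivative_mult_right has_derivative_mult q diag_power_slice[OF w])
  then have d: "((\<lambda>s. wirtinger_bar (Some i) (diag_power K \<alpha>) (w + axis j s)) has_derivative
      (\<lambda>h. of_real \<alpha> * (diag_power K (\<alpha> - 1) (w + axis j 0) * (ddbar j i w * h + q * cnj h)
        + (a * cnj (dbar j w w) * h + a * dbar j w w * cnj h) * dbar i (w + axis j 0) (w + axis j 0)))) (at 0)"
  proof (rule has_derivative_transform_within_open[of _ _ _ _ "ball 0 e"])
    fix s :: complex assume "s \<in> ball 0 e"
    then have "w + axis j s \<in> \<Omega>" using e by (auto simp: subset_iff dist_norm)
    from wirtinger_bar_diag_power[OF this]
    show "of_real \<alpha> * (diag_power K (\<alpha> - 1) (w + axis j s) * dbar i (w + axis j s) (w + axis j s))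
        = wirtinger_bar (Some i) (diag_power K \<alpha>) (w + axis j s)" by simp
  qed (use e in auto)
  have eq: "(\<lambda>h. of_real \<alpha> * (diag_power K (\<alpha> - 1) (w + axis j 0) * (ddbar j i w * h + q * cnj h)
        + (a * cnj (dbar j w w) * h + a * dbar j w w * cnj h) * dbar i (w + axis j 0) (w + axis j 0)))
    = (\<lambda>h. of_real \<alpha> * (a * cnj (dbar j w w) * dbar i w w + diag_power K (\<alpha> - 1) w * ddbar j i w) * h
        + of_real \<alpha> * (a * dbar j w w * dbar i w w + diag_power K (\<alpha> - 1) w * q) * cnj h)"
    by (simp add: algebra_simps)
  show ?thesis
    by (subst wirtinger_slice(1)[OF d[unfolded eq]]) (simp add: a_def diag_power_def)
qed

section \<open>First-order jets as limits of Gram forms\<close>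

text \<open>In the reproducing kernel space this is the squared norm of \<open>x\<close> times
  \<open>K(., w)\<close> plus the \<open>v i\<close> multiples of its conjugate derivatives at
  \<open>w\<close>. Its rows carry the holomorphic derivatives, the transpose of the convention in
  \<open>jet_matrix\<close>, so coefficients are conjugated when the two meet.\<close>

definition jet_form :: "complex ^ 'm \<Rightarrow> complex \<Rightarrow> ('m \<Rightarrow> complex) \<Rightarrow> complex" where
  "jet_form w x v = cnj x * K w w * x + cnj x * (\<Sum>i\<in>UNIV. dbar i w w * v i)
     + (\<Sum>j\<in>UNIV. cnj (v j) * cnj (dbar j w w)) * x
     + (\<Sum>j\<in>UNIV. \<Sum>i\<in>UNIV. cnj (v j) * ddbar j i w * v i)"

text \<open>\<open>gram_Cauchy_Schwarz\<close> is applied to \<open>w\<close> and its neighbours at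
  distance \<open>h\<close> along the axes, weighted so as to form difference quotients, and
  \<open>h\<close> tends to 0 from the right.\<close>

lemma jet_Cauchy_Schwarz:
  assumes w: "w \<in> \<Omega>" and z: "z \<in> \<Omega>"
  shows "jet_form w x v \<in> \<real>"
    and "(norm (K z w * x + (\<Sum>i\<in>UNIV. dbar i z w * v i)))\<^sup>2 \<le> Re (K z z) * Re (jet_form w x v)"
proof -
  obtain r M where r: "0 < r" "ball w (3 * r) \<subseteq> \<Omega>" and
    M: "\<And>z y. z \<in> ball w (3 * r) \<Longrightarrow> y \<in> ball w (3 * r) \<Longrightarrow> norm (K z y) < M"
    by (rule locally_bounded[OF w]) blast
  have in_ball: "w + axis j s \<in> ball w (3 * r)" if "s \<in> ball 0 r" for s j
    using that r(1) by (simp add: dist_norm)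
  define p where "p h = (\<lambda>a. case a of None \<Rightarrow> w | Some i \<Rightarrow> w + axis i (complex_of_real h))" for h
  define c where "c h = (\<lambda>a. case a of None \<Rightarrow> x - (\<Sum>i\<in>UNIV. v i / complex_of_real h)
      | Some i \<Rightarrow> v i / complex_of_real h)" for h
  define S where "S h = (\<Sum>b\<in>UNIV. K z (p h b) * c h b)" for h
  define Q where "Q h = (\<Sum>a\<in>UNIV. \<Sum>b\<in>UNIV. cnj (c h a) * K (p h a) (p h b) * c h b)" for h
  have at_right: "filterlim complex_of_real (at 0) (at_right 0)"
    unfolding filterlim_at by (auto intro!: tendsto_eq_intros simp: eventually_at_filter)
  have quotient: "((\<lambda>h::real. (f (of_real h) - f 0) / of_real h) \<longlongrightarrow> D) (at_right 0)"
    if "(f has_field_derivative D) (at 0)" for f :: "complex \<Rightarrow> complex" and D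
  proof -
    have "((\<lambda>s. (f s - f 0) / s) \<longlongrightarrow> D) (at 0)" using that by (simp add: has_field_derivative_iff)
    from filterlim_compose[OF this at_right] show ?thesis .
  qed
  have snd_lim: "((\<lambda>h::real. (K y (w + axis i (of_real h)) - K y w) / of_real h) \<longlongrightarrow> dbar i y w) (at_right 0)"
    if "y \<in> \<Omega>" for y i
    using quotient[OF snd_has_dbar[OF that w]] by simp
  have fst_lim: "((\<lambda>h::real. (K (w + axis i (of_real h)) w - K w w) / of_real h)
      \<longlongrightarrow> cnj (dbar i w w)) (at_right 0)" for i
    using quotient[OF fst_has_cnj_dbar[OF w w]] by simp
  have mixed_lim: "((\<lambda>h::real. (K (w + axis j (of_real h)) (w + axis i (of_real h))
        - K (w + axis j (of_real h)) w - K w (w + axis i (of_real h)) + K w w)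
        / (of_real h * of_real h)) \<longlongrightarrow> ddbar j i w) (at_right 0)" for i j
  proof -
    have "separately_holomorphic (\<lambda>s t. K (w + axis j s) (w + axis i (cnj t))) r"
      by (rule slice_separately_holomorphic) (use in_ball r in auto)
    from mixed_difference_quotient_tendsto[OF this r(1), of M]
    show ?thesis using M in_ball by (simp add: ddbar_def dbar_def)
  qed
  have S_eq: "S h = K z w * x
      + (\<Sum>i\<in>UNIV. (K z (w + axis i (of_real h)) - K z w) / of_real h * v i)" for h
    unfolding S_def c_def sum_UNIV_option_difference_stencil by (simp add: p_def)
  have S_lim: "(S \<longlongrightarrow> K z w * x + (\<Sum>i\<in>UNIV. dbar i z w * v i)) (at_right 0)"
    unfolding S_eq[abs_def] by (intro tendsto_intros snd_lim z)
  \<comment> \<open>Each row sum of the Gram form is a discrete jet in the second argument; applying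
    the same stencil to \<open>T h\<close> in the first argument produces the mixed second
    differences.\<close>
  define T where "T h y = K y w * x
      + (\<Sum>i\<in>UNIV. (K y (w + axis i (of_real h)) - K y w) / of_real h * v i)" for h :: real and y
  have T_eq: "(\<Sum>b\<in>UNIV. K y (p h b) * c h b) = T h y" for h y
    unfolding c_def sum_UNIV_option_difference_stencil by (simp add: p_def T_def)
  have Q_eq: "Q h = T h w * cnj x
      + (\<Sum>j\<in>UNIV. (T h (w + axis j (of_real h)) - T h w) / of_real h * cnj (v j))" for h
  proof -
    have "Q h = (\<Sum>a\<in>UNIV. T h (p h a) * cnj (c h a))"
      by (simp add: Q_def T_eq[symmetric] sum_distrib_left mult_ac)
    also have "\<dots> = (\<Sum>a\<in>UNIV. T h (p h a) * (case a of None \<Rightarrow> cnj x - (\<Sum>i\<in>UNIV. cnj (v i) / of_real h)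
      | Some i \<Rightarrow> cnj (v i) / of_real h))"
      by (intro sum.cong refl) (auto simp: c_def split: option.split)
    also have "\<dots> = T h w * cnj x
      + (\<Sum>j\<in>UNIV. (T h (w + axis j (of_real h)) - T h w) / of_real h * cnj (v j))"
      unfolding sum_UNIV_option_difference_stencil by (simp add: p_def)
    finally show ?thesis .
  qed
  have T_diff: "(T h (w + axis j (of_real h)) - T h w) / of_real h
      = (K (w + axis j (of_real h)) w - K w w) / of_real h * x
        + (\<Sum>i\<in>UNIV. (K (w + axis j (of_real h)) (w + axis i (of_real h))
        - K (w + axis j (of_real h)) w - K w (w + axis i (of_real h)) + K w w)
        / (of_real h * of_real h) * v i)" for h j
    unfolding T_def
    by (simp add: diff_divide_distrib add_divide_distrib algebra_simps sum_subtractf sum.distrib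
        sum_divide_distrib)
  have "(Q \<longlongrightarrow> (K w w * x + (\<Sum>i\<in>UNIV. dbar i w w * v i)) * cnj x
      + (\<Sum>j\<in>UNIV. (cnj (dbar j w w) * x + (\<Sum>i\<in>UNIV. ddbar j i w * v i)) * cnj (v j))) (at_right 0)"
    unfolding Q_eq[abs_def] T_diff unfolding T_def
    by (intro tendsto_intros snd_lim fst_lim mixed_lim w)
  also have "(K w w * x + (\<Sum>i\<in>UNIV. dbar i w w * v i)) * cnj x
      + (\<Sum>j\<in>UNIV. (cnj (dbar j w w) * x + (\<Sum>i\<in>UNIV. ddbar j i w * v i)) * cnj (v j))
      = jet_form w x v"
    by (simp add: jet_form_def algebra_simps sum.distrib sum_distrib_left)
  finally have Q_lim: "(Q \<longlongrightarrow> jet_form w x v) (at_right 0)" .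
  have ev: "\<forall>\<^sub>F h in at_right (0::real). range (p h) \<subseteq> \<Omega>"
    unfolding eventually_at_right_field
  proof (intro exI conjI allI impI)
    fix h :: real assume "0 < h" "h < r"
    then have "p h a \<in> \<Omega>" for a
      using in_ball[of "of_real h"] r(2) w by (cases a) (auto simp: p_def)
    then show "range (p h) \<subseteq> \<Omega>" by blast
  qed (rule r(1))
  show "jet_form w x v \<in> \<real>"
  proof (rule Lim_in_closed_set[OF closed_complex_Reals _ _ Q_lim])
    show "\<forall>\<^sub>F h in at_right 0. Q h \<in> \<real>"
      using ev by eventually_elim (simp add: Q_def gram_nonneg)
  qed simp
  show "(norm (K z w * x + (\<Sum>i\<in>UNIV. dbar i z w * v i)))\<^sup>2 \<le> Re (K z z) * Re (jet_form w x v)"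
  proof (rule tendsto_le[rotated])
    show "((\<lambda>h. Re (K z z) * Re (Q h)) \<longlongrightarrow> Re (K z z) * Re (jet_form w x v)) (at_right 0)"
      by (intro tendsto_intros Q_lim)
    show "((\<lambda>h. (norm (S h))\<^sup>2) \<longlongrightarrow> (norm (K z w * x + (\<Sum>i\<in>UNIV. dbar i z w * v i)))\<^sup>2) (at_right 0)"
      by (intro tendsto_intros S_lim)
    show "\<forall>\<^sub>F h in at_right 0. (norm (S h))\<^sup>2 \<le> Re (K z z) * Re (Q h)"
      using ev by eventually_elim (simp add: S_def Q_def gram_Cauchy_Schwarz z del: Re_sum)
  qed simp
qed

section \<open>Completing the square and definiteness\<close>

text \<open>The coefficient \<open>\<alpha> * (\<alpha> - 1) / k\<^sup>2\<close> of
  \<open>(norm s)\<^sup>2\<close> splits into \<open>(\<alpha> / k)\<^sup>2\<close>, which completes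
  the square with \<open>v $ None\<close>, and \<open>- \<alpha> / k\<^sup>2\<close>, which joins
  \<open>q\<close>.\<close>

lemma hermitian_form_jet_matrix:
  fixes v :: "complex ^ 'm option"
  assumes w: "w \<in> \<Omega>"
  defines "k \<equiv> Re (K w w)"
    and "s \<equiv> (\<Sum>j\<in>UNIV. cnj (dbar j w w) * v $ Some j)"
    and "q \<equiv> jet_form w 0 (\<lambda>i. cnj (v $ Some i))"
  shows "hermitian_form (jet_matrix K \<alpha> w) v = of_real (k powr \<alpha>) *
    (of_real ((norm (v $ None + of_real (\<alpha> / k) * s))\<^sup>2) + of_real (\<alpha> / k) * (q - of_real ((norm s)\<^sup>2 / k)))"
proof -
  have k: "0 < k" unfolding k_def by (rule diagonal_pos[OF w])
  define A where "A = complex_of_real (k powr \<alpha>)"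
  define kc where "kc = complex_of_real k"
  define al where "al = complex_of_real \<alpha>"
  have kc: "kc \<noteq> 0" using k by (simp add: kc_def)
  have pw: "diag_power K \<alpha> w = A" "diag_power K (\<alpha> - 1) w = A / kc"
    "diag_power K (\<alpha> - 2) w = A / kc\<^sup>2"
    using k by (simp_all add: diag_power_def A_def kc_def k_def[symmetric] powr_diff powr_numeral)
  have cs: "cnj s = (\<Sum>j\<in>UNIV. cnj (v $ Some j) * dbar j w w)"
    by (simp add: s_def mult.commute)
  have q: "q = (\<Sum>i\<in>UNIV. \<Sum>j\<in>UNIV. cnj (v $ Some i) * ddbar j i w * v $ Some j)"
    unfolding q_def jet_form_def by (subst sum.swap) (simp add: mult_ac)
  have "hermitian_form (jet_matrix K \<alpha> w) v
      = cnj (v $ None) * A * v $ None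
      + (\<Sum>j\<in>UNIV. cnj (v $ None) * (al * (A / kc) * cnj (dbar j w w)) * v $ Some j)
      + (\<Sum>i\<in>UNIV. cnj (v $ Some i) * (al * (A / kc) * dbar i w w) * v $ None
         + (\<Sum>j\<in>UNIV. cnj (v $ Some i) * (al * ((al - 1) * (A / kc\<^sup>2) * cnj (dbar j w w) * dbar i w w
        + A / kc * ddbar j i w)) * v $ Some j))"
    using w
    by (simp add: hermitian_form_def sum_UNIV_option jet_matrix_def wirtinger_bar_diag_power
        wirtinger_diag_power wirtinger_wirtinger_bar_diag_power pw al_def del: wirtinger.simps(2) wirtinger_bar.simps(2))
  also have "\<dots> = cnj (v $ None) * A * v $ None
      + cnj (v $ None) * al * (A / kc) * s
      + cnj s * al * (A / kc) * v $ None
      + al * (al - 1) * (A / kc\<^sup>2) * (cnj s * s) + al * (A / kc) * q"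
  proof -
    have 1: "(\<Sum>j\<in>UNIV. cnj (v $ None) * (al * (A / kc) * cnj (dbar j w w)) * v $ Some j)
        = cnj (v $ None) * al * (A / kc) * s"
      unfolding s_def sum_distrib_left by (simp add: mult_ac)
    have 2: "(\<Sum>i\<in>UNIV. cnj (v $ Some i) * (al * (A / kc) * dbar i w w) * v $ None)
        = cnj s * al * (A / kc) * v $ None"
      unfolding cs sum_distrib_right by (simp add: mult_ac)
    have 3: "(\<Sum>i\<in>UNIV. \<Sum>j\<in>UNIV. cnj (v $ Some i) * (al * ((al - 1) * (A / kc\<^sup>2) * cnj (dbar j w w) * dbar i w w
        + A / kc * ddbar j i w)) * v $ Some j)
        = al * (al - 1) * (A / kc\<^sup>2) * (cnj s * s) + al * (A / kc) * q"
    proof -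
      have ss: "cnj s * s = (\<Sum>i\<in>UNIV. \<Sum>j\<in>UNIV. cnj (v $ Some i) * dbar i w w * (cnj (dbar j w w) * v $ Some j))"
        unfolding cs unfolding s_def by (rule sum_product)
      show ?thesis
        unfolding ss q sum_distrib_left sum.distrib[symmetric]
        by (intro sum.cong refl) (simp add: algebra_simps)
    qed
    show ?thesis unfolding sum.distrib 1 2 3 by simp
  qed
  also have "\<dots> = A * ((v $ None + al / kc * s) * cnj (v $ None + al / kc * s)
      + al / kc * (q - s * cnj s / kc))"
    using kc by (simp add: al_def kc_def field_simps power2_eq_square)
  finally show ?thesis
    by (simp add: A_def al_def kc_def complex_norm_square del: of_real_power)
qed

end

theorem lemma5p3:
  fixes \<Omega> :: "(complex ^ 'm) set"
    and K :: "complex ^ 'm \<Rightarrow> complex ^ 'm \<Rightarrow> complex"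
    and lam :: real and w :: "complex ^ 'm"
  assumes "open \<Omega>" and "connected \<Omega>"
    and "sesquiholomorphic_on K \<Omega>"
    and "nonneg_definite_kernel_on K \<Omega>"
    and "\<And>u. u \<in> \<Omega> \<Longrightarrow> 0 < Re (K u u)"
    and "continuous_on \<Omega> (\<lambda>u. K u u)"
    and "0 < lam" and "w \<in> \<Omega>"
  shows "nonneg_definite_matrix (jet_matrix K lam w) \<and>
    (first_order_strict_at K \<Omega> w \<longrightarrow> positive_definite_matrix (jet_matrix K lam w))"
proof -
  interpret sesquiholomorphic_kernel \<Omega> K
    using assms by unfold_locales auto
  note w = \<open>w \<in> \<Omega>\<close>
  define k where "k = Re (K w w)"
  have k: "0 < k" "K w w = of_real k" using diagonal_pos[OF w] diagonal_real[OF w] by (auto simp: k_def)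
  define s where "s v = (\<Sum>j\<in>UNIV. cnj (dbar j w w) * v $ Some j)" for v :: "complex ^ 'm option"
  define q where "q v = jet_form w 0 (\<lambda>i. cnj (v $ Some i))" for v :: "complex ^ 'm option"
  define N where "N v = (norm (v $ None + of_real (lam / k) * s v))\<^sup>2" for v
  define E where "E v = Re (q v) - (norm (s v))\<^sup>2 / k" for v
  have cs: "cnj (s v) = (\<Sum>i\<in>UNIV. dbar i w w * cnj (v $ Some i))" for v
    by (simp add: s_def)
  have "q v = of_real (Re (q v))" for v
    using jet_Cauchy_Schwarz(1)[OF w w] by (simp add: q_def complex_is_Real_iff complex_eq_iff)
  then have form: "hermitian_form (jet_matrix K lam w) v
      = of_real (k powr lam * (N v + lam / k * E v))" for v
    using hermitian_form_jet_matrix[OF w, of lam v]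
    by (simp add: k_def s_def q_def N_def E_def del: of_real_power)
  have E: "0 \<le> E v" for v
  proof -
    have "(norm (s v))\<^sup>2 \<le> k * Re (q v)"
      using jet_Cauchy_Schwarz(2)[OF w w, of 0 "\<lambda>i. cnj (v $ Some i)"]
      unfolding cs[symmetric] k_def q_def by simp
    then show ?thesis using k(1) by (simp add: E_def divide_le_eq mult.commute)
  qed
  have pos: "0 \<le> N v + lam / k * E v" for v
    using E[of v] k(1) \<open>0 < lam\<close> by (simp add: N_def)
  show ?thesis
  proof (intro conjI impI)
    show "nonneg_definite_matrix (jet_matrix K lam w)"
      using pos unfolding nonneg_definite_matrix_def form by simp
    assume strict: "first_order_strict_at K \<Omega> w"
    have "v = 0" if "N v + lam / k * E v = 0" for v
    proof -
      have "0 \<le> N v" "0 \<le> lam / k * E v" using E[of v] k(1) \<open>0 < lam\<close> by (simp_all add: N_def)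
      with that have "N v = 0" "lam / k * E v = 0" by linarith+
      then have N0: "v $ None = - of_real (lam / k) * s v" and E0: "E v = 0"
        using k(1) \<open>0 < lam\<close> by (auto simp: N_def eq_neg_iff_add_eq_0)
      \<comment> \<open>This value minimizes \<open>jet_form\<close> for the given remaining
        coefficients, and the minimum is \<open>E v\<close>, here 0. It is not the conjugate of
        \<open>v $ None\<close>, which by \<open>N0\<close> equals \<open>lam\<close> times
        \<open>x\<close>.\<close>
      define x where "x = - cnj (s v) / of_real k"
      define c where "c = (\<chi> a. case a of None \<Rightarrow> x | Some i \<Rightarrow> cnj (v $ Some i))"
      have "jet_form w x (\<lambda>i. cnj (v $ Some i)) = cnj x * of_real k * x + cnj x * cnj (s v) + s v * x + q v"
        by (simp add: jet_form_def k(2) cs q_def s_def mult.commute)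
      also have "\<dots> = q v - of_real ((norm (s v))\<^sup>2 / k)"
        using k(1) complex_norm_square[of "s v"] by (simp add: x_def field_simps)
      finally have J0: "Re (jet_form w x (\<lambda>i. cnj (v $ Some i))) = 0"
        using E0 by (simp add: E_def)
      have "(\<Sum>a\<in>UNIV. c $ a * wirtinger_bar a (\<lambda>u. K z u) w) = 0" if z: "z \<in> \<Omega>" for z
      proof -
        have "(\<Sum>a\<in>UNIV. c $ a * wirtinger_bar a (\<lambda>u. K z u) w)
            = K z w * x + (\<Sum>i\<in>UNIV. dbar i z w * cnj (v $ Some i))"
          by (simp add: sum_UNIV_option c_def wirtinger_bar_snd[OF z w] mult.commute
              del: wirtinger_bar.simps(2))
        then show ?thesis
          using jet_Cauchy_Schwarz(2)[OF w z, of x "\<lambda>i. cnj (v $ Some i)"] J0 by simp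
      qed
      then have "c = 0" using strict unfolding first_order_strict_at_def by blast
      \<comment> \<open>Only the derivative entries of \<open>c\<close> are read off; they force
        \<open>s v = 0\<close>, and then \<open>N0\<close> gives the entry at
        \<open>None\<close>.\<close>
      have v0: "v $ Some i = 0" for i
        using arg_cong[OF \<open>c = 0\<close>, of "\<lambda>c. c $ Some i"] by (simp add: c_def)
      then have "v $ a = 0" for a
        using N0 by (cases a) (auto simp: s_def)
      then show "v = 0" by (simp add: vec_eq_iff)
    qed
    then have "0 < N v + lam / k * E v" if "v \<noteq> 0" for v
      using pos[of v] that by (metis order_le_less)
    then show "positive_definite_matrix (jet_matrix K lam w)"
      using k(1) unfolding positive_definite_matrix_def form by simp
  qed
qed

end
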